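(* Let $\mathcal{S}$ be a triangulated category and let $(\mathcal{P},\mathcal{I})$ be a projective class in $\mathcal{S}$. For each integer $n\ge 1$, let $\mathcal{I}^n$ be the class of all $n$-fold composites of maps in $\mathcal{I}$, and define classes of objects by $\mathcal{P}_1=\mathcal{P}$ and, inductively, $\mathcal{P}_n=$ the class of all retracts of objects $Y$ that sit in a cofibre sequence $X\to Y\to P$ with $X$ in $\mathcal{P}_{n-1}$ and $P$ in $\mathcal{P}$. Then for each $n$ the pair $(\mathcal{P}_n,\mathcal{I}^n)$ is a projective class.
   Context: Cofibre sequence means exact triangle: $A\to B\to C$ is a cofibre sequence if it extends to an exact triangle $A\to B\to C\to\Sigma A$. For a class $\mathcal{P}$ of objects, $\mathcal{P}\text{-null}$ is the class of all maps $X\to Y$ such that the composite $P\to X\to Y$ is zero for all $P$ in $\mathcal{P}$ and all maps $P\to X$. For a class $\mathcal{I}$ of maps, $\mathcal{I}\text{-proj}$ is the class of all objects $P$ such that the composite $P\to X\to Y$ is zero for all maps $X\to Y$ in $\mathcal{I}$ and all maps $P\to X$. A projective class is a pair $(\mathcal{P},\mathcal{I})$, with $\mathcal{P}$ a class of objects and $\mathcal{I}$ a class of maps, such that $\mathcal{P}\text{-null}=\mathcal{I}$, $\mathcal{I}\text{-proj}=\mathcal{P}$, and each object $X$ lies in a cofibre sequence $P\to X\to Y$ with $P$ in $\mathcal{P}$ and $X\to Y$ in $\mathcal{I}$. *)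

theory Defs
  imports "HOL-Algebra.Group"
begin

text \<open>
  A category is given by a set of objects and a set of arrows, with total functions
  for domain, codomain, identities and composition; these are only meaningful on the carriers
  (and composition only on composable pairs). \<open>g \<cdot> f\<close> means \<open>g\<close> after \<open>f\<close>.
\<close>

record ('o, 'm) category =
  Obj :: "'o set"
  Arr :: "'m set"
  Dom :: "'m \<Rightarrow> 'o"
  Cod :: "'m \<Rightarrow> 'o"
  Ide :: "'o \<Rightarrow> 'm"
  Comp :: "'m \<Rightarrow> 'm \<Rightarrow> 'm" (infixr "\<cdot>\<index>" 70)

definition maps :: "('o, 'm, 'e) category_scheme \<Rightarrow> 'o \<Rightarrow> 'o \<Rightarrow> 'm set" where
  "maps S A B = {f \<in> Arr S. Dom S f = A \<and> Cod S f = B}"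

locale category =
  fixes S :: "('o, 'm, 'e) category_scheme" (structure)
  assumes dom_obj: "f \<in> Arr S \<Longrightarrow> Dom S f \<in> Obj S"
    and cod_obj: "f \<in> Arr S \<Longrightarrow> Cod S f \<in> Obj S"
    and ide_maps: "A \<in> Obj S \<Longrightarrow> Ide S A \<in> maps S A A"
    and comp_maps: "\<lbrakk>f \<in> maps S A B; g \<in> maps S B C\<rbrakk> \<Longrightarrow> g \<cdot> f \<in> maps S A C"
    and comp_ide_right: "f \<in> maps S A B \<Longrightarrow> f \<cdot> Ide S A = f"
    and comp_ide_left: "f \<in> maps S A B \<Longrightarrow> Ide S B \<cdot> f = f"
    and comp_assoc: "\<lbrakk>f \<in> maps S A B; g \<in> maps S B C; h \<in> maps S C D\<rbrakk>
                       \<Longrightarrow> (h \<cdot> g) \<cdot> f = h \<cdot> (g \<cdot> f)"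

definition iso_maps :: "('o, 'm, 'e) category_scheme \<Rightarrow> 'o \<Rightarrow> 'o \<Rightarrow> 'm set" where
  "iso_maps S A B = {f \<in> maps S A B. \<exists>g \<in> maps S B A.
     Comp S g f = Ide S A \<and> Comp S f g = Ide S B}"

definition is_retract :: "('o, 'm, 'e) category_scheme \<Rightarrow> 'o \<Rightarrow> 'o \<Rightarrow> bool" where
  "is_retract S A Y \<longleftrightarrow> A \<in> Obj S \<and> Y \<in> Obj S \<and>
     (\<exists>i \<in> maps S A Y. \<exists>r \<in> maps S Y A. Comp S r i = Ide S A)"

record ('o, 'm) ab_category = "('o, 'm) category" +
  Add :: "'m \<Rightarrow> 'm \<Rightarrow> 'm" (infixl "\<oplus>\<index>" 65)
  Zero :: "'o \<Rightarrow> 'o \<Rightarrow> 'm"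

text \<open>The abelian group of maps from \<open>A\<close> to \<open>B\<close>, written as a HOL-Algebra monoid.\<close>

definition hom_group :: "('o, 'm, 'e) ab_category_scheme \<Rightarrow> 'o \<Rightarrow> 'o \<Rightarrow> 'm monoid" where
  "hom_group S A B = \<lparr>carrier = maps S A B, mult = Add S, one = Zero S A B\<rparr>"

definition Neg :: "('o, 'm, 'e) ab_category_scheme \<Rightarrow> 'm \<Rightarrow> 'm" where
  "Neg S f = inv\<^bsub>hom_group S (Dom S f) (Cod S f)\<^esub> f"

definition zero_object :: "('o, 'm, 'e) category_scheme \<Rightarrow> 'o \<Rightarrow> bool" where
  "zero_object S Z \<longleftrightarrow> Z \<in> Obj S \<and>
     (\<forall>A \<in> Obj S. (\<exists>!f. f \<in> maps S A Z) \<and> (\<exists>!f. f \<in> maps S Z A))"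

locale additive_category = category S
  for S :: "('o, 'm, 'e) ab_category_scheme" (structure) +
  assumes hom_group: "\<lbrakk>A \<in> Obj S; B \<in> Obj S\<rbrakk> \<Longrightarrow> comm_group (hom_group S A B)"
    and comp_add_right: "\<lbrakk>f \<in> maps S A B; f' \<in> maps S A B; g \<in> maps S B C\<rbrakk>
                           \<Longrightarrow> g \<cdot> (f \<oplus> f') = g \<cdot> f \<oplus> g \<cdot> f'"
    and comp_add_left: "\<lbrakk>f \<in> maps S A B; g \<in> maps S B C; g' \<in> maps S B C\<rbrakk>
                          \<Longrightarrow> (g \<oplus> g') \<cdot> f = g \<cdot> f \<oplus> g' \<cdot> f"
    and zero_object_exists: "\<exists>Z. zero_object S Z"
    and biproduct_exists: "\<lbrakk>A \<in> Obj S; B \<in> Obj S\<rbrakk> \<Longrightarrow>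
      \<exists>C \<in> Obj S. \<exists>i \<in> maps S A C. \<exists>j \<in> maps S B C. \<exists>p \<in> maps S C A. \<exists>q \<in> maps S C B.
        p \<cdot> i = Ide S A \<and> q \<cdot> j = Ide S B \<and> q \<cdot> i = Zero S A B \<and> p \<cdot> j = Zero S B A \<and>
        i \<cdot> p \<oplus> j \<cdot> q = Ide S C"

text \<open>
  \<open>SusO\<close> and \<open>SusM\<close> are the suspension \<open>\<Sigma>\<close> on objects and on maps. \<open>Exact S u v w\<close> says that
  \<open>X \<rightarrow> Y \<rightarrow> Z \<rightarrow> \<Sigma>X\<close> with maps \<open>u, v, w\<close> is an exact (distinguished) triangle; the objects are
  recovered from domains and codomains.
\<close>

record ('o, 'm) tri_category = "('o, 'm) ab_category" +
  SusO :: "'o \<Rightarrow> 'o"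
  SusM :: "'m \<Rightarrow> 'm"
  Exact :: "'m \<Rightarrow> 'm \<Rightarrow> 'm \<Rightarrow> bool"

definition triangle :: "('o, 'm, 'e) tri_category_scheme \<Rightarrow> 'm \<Rightarrow> 'm \<Rightarrow> 'm \<Rightarrow> bool" where
  "triangle S u v w \<longleftrightarrow> u \<in> Arr S \<and> v \<in> Arr S \<and> w \<in> Arr S \<and>
     Cod S u = Dom S v \<and> Cod S v = Dom S w \<and> Cod S w = SusO S (Dom S u)"

text \<open>
  The axioms of Verdier, including the octahedral axiom. The suspension is only required to be
  an additive self-equivalence (fully faithful and essentially surjective), which includes the
  case of an automorphism; the rotation axiom is an equivalence, so no inverse of the
  suspension is needed to state it.
\<close>

locale triangulated_category = additive_category S
  for S :: "('o, 'm, 'e) tri_category_scheme" (structure) +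
  assumes sus_obj: "A \<in> Obj S \<Longrightarrow> SusO S A \<in> Obj S"
    and sus_maps: "f \<in> maps S A B \<Longrightarrow> SusM S f \<in> maps S (SusO S A) (SusO S B)"
    and sus_ide: "A \<in> Obj S \<Longrightarrow> SusM S (Ide S A) = Ide S (SusO S A)"
    and sus_comp: "\<lbrakk>f \<in> maps S A B; g \<in> maps S B C\<rbrakk> \<Longrightarrow> SusM S (g \<cdot> f) = SusM S g \<cdot> SusM S f"
    and sus_add: "\<lbrakk>f \<in> maps S A B; g \<in> maps S A B\<rbrakk> \<Longrightarrow> SusM S (f \<oplus> g) = SusM S f \<oplus> SusM S g"
    and sus_fully_faithful: "\<lbrakk>A \<in> Obj S; B \<in> Obj S\<rbrakk> \<Longrightarrow>
          bij_betw (SusM S) (maps S A B) (maps S (SusO S A) (SusO S B))"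
    and sus_ess_surj: "B \<in> Obj S \<Longrightarrow> \<exists>A \<in> Obj S. iso_maps S (SusO S A) B \<noteq> {}"
    and exact_triangle: "Exact S u v w \<Longrightarrow> triangle S u v w"
    and exact_iso: "\<lbrakk>Exact S u v w; triangle S u' v' w';
          a \<in> iso_maps S (Dom S u) (Dom S u');
          b \<in> iso_maps S (Dom S v) (Dom S v');
          c \<in> iso_maps S (Dom S w) (Dom S w');
          b \<cdot> u = u' \<cdot> a; c \<cdot> v = v' \<cdot> b; SusM S a \<cdot> w = w' \<cdot> c\<rbrakk> \<Longrightarrow> Exact S u' v' w'"
    and exact_ide: "\<lbrakk>X \<in> Obj S; zero_object S Z\<rbrakk> \<Longrightarrow>
          Exact S (Ide S X) (Zero S X Z) (Zero S Z (SusO S X))"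
    and exact_extend: "u \<in> Arr S \<Longrightarrow> \<exists>v w. Exact S u v w"
    and exact_rotate: "triangle S u v w \<Longrightarrow> Exact S u v w \<longleftrightarrow> Exact S v w (Neg S (SusM S u))"
    and exact_fill: "\<lbrakk>Exact S u v w; Exact S u' v' w';
          a \<in> maps S (Dom S u) (Dom S u'); b \<in> maps S (Dom S v) (Dom S v');
          b \<cdot> u = u' \<cdot> a\<rbrakk> \<Longrightarrow>
          \<exists>c \<in> maps S (Dom S w) (Dom S w'). c \<cdot> v = v' \<cdot> b \<and> SusM S a \<cdot> w = w' \<cdot> c"
    and octahedral: "\<lbrakk>Exact S u j k; Exact S v l i; Exact S (v \<cdot> u) m n; Cod S u = Dom S v\<rbrakk> \<Longrightarrow>
          \<exists>f \<in> maps S (Cod S j) (Cod S m). \<exists>g \<in> maps S (Cod S m) (Cod S l).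
            Exact S f g (SusM S j \<cdot> i) \<and>
            f \<cdot> j = m \<cdot> v \<and> n \<cdot> f = k \<and> g \<cdot> m = l \<and> i \<cdot> g = SusM S u \<cdot> n"

definition cofibre_sequence :: "('o, 'm, 'e) tri_category_scheme \<Rightarrow> 'm \<Rightarrow> 'm \<Rightarrow> bool" where
  "cofibre_sequence S u v \<longleftrightarrow> (\<exists>w. Exact S u v w)"

definition null_maps :: "('o, 'm, 'e) ab_category_scheme \<Rightarrow> 'o set \<Rightarrow> 'm set" where
  "null_maps S P = {f \<in> Arr S. \<forall>A \<in> P. \<forall>g \<in> maps S A (Dom S f).
     Comp S f g = Zero S A (Cod S f)}"

definition proj_objects :: "('o, 'm, 'e) ab_category_scheme \<Rightarrow> 'm set \<Rightarrow> 'o set" where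
  "proj_objects S I = {A \<in> Obj S. \<forall>f \<in> I. \<forall>g \<in> maps S A (Dom S f).
     Comp S f g = Zero S A (Cod S f)}"

definition projective_class ::
  "('o, 'm, 'e) tri_category_scheme \<Rightarrow> 'o set \<Rightarrow> 'm set \<Rightarrow> bool" where
  "projective_class S P I \<longleftrightarrow> P \<subseteq> Obj S \<and> I \<subseteq> Arr S \<and>
     null_maps S P = I \<and> proj_objects S I = P \<and>
     (\<forall>X \<in> Obj S. \<exists>A \<in> P. \<exists>Y \<in> Obj S. \<exists>u \<in> maps S A X. \<exists>v \<in> maps S X Y.
        cofibre_sequence S u v \<and> v \<in> I)"

text \<open>Both families below start at index 1; the value at 0 is a dummy.\<close>

fun composites :: "('o, 'm, 'e) category_scheme \<Rightarrow> 'm set \<Rightarrow> nat \<Rightarrow> 'm set" where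
  "composites S I 0 = {}"
| "composites S I (Suc 0) = I"
| "composites S I (Suc (Suc n)) =
     {Comp S g f | f g. f \<in> composites S I (Suc n) \<and> g \<in> I \<and> Cod S f = Dom S g}"

fun iterated_ext :: "('o, 'm, 'e) tri_category_scheme \<Rightarrow> 'o set \<Rightarrow> nat \<Rightarrow> 'o set" where
  "iterated_ext S P 0 = {}"
| "iterated_ext S P (Suc 0) = P"
| "iterated_ext S P (Suc (Suc n)) =
     {A. \<exists>Y. is_retract S A Y \<and>
        (\<exists>X \<in> iterated_ext S P (Suc n). \<exists>B \<in> P. \<exists>u \<in> maps S X Y. \<exists>v \<in> maps S Y B.
           cofibre_sequence S u v)}"

end

theory Submission
  imports Defs
begin

text \<open>
  Five conditions suffice for \<open>(Q, J)\<close> to be a projective class: \<open>Q\<close> is closed under retracts,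
  \<open>J\<close> is closed under composing with further maps on the left, every composite
  \<open>A \<rightarrow> X \<rightarrow> Y\<close> with \<open>A\<close> in \<open>Q\<close> and \<open>X \<rightarrow> Y\<close> in \<open>J\<close> is zero, every object sits in a
  cofibre sequence \<open>A \<rightarrow> X \<rightarrow> Y\<close> with \<open>A\<close> in \<open>Q\<close> and \<open>X \<rightarrow> Y\<close> in \<open>J\<close>, and both classes
  consist of objects and maps of the category (\<open>projective_classI\<close>). Indeed a map
  out of \<open>X\<close> that kills all maps from \<open>Q\<close> kills \<open>A \<rightarrow> X\<close>, so it factors through \<open>X \<rightarrow> Y\<close> and lies
  in \<open>J\<close>; and if \<open>X\<close> is \<open>J\<close>-projective, then \<open>X \<rightarrow> Y\<close> is zero, so the identity of \<open>X\<close> lifts to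
  \<open>A\<close> and \<open>X\<close> is a retract of \<open>A\<close>.

  For \<open>P\<^sub>n\<close> and the \<open>n\<close>-fold composites of \<open>I\<close>, only orthogonality and the existence of cofibre
  sequences require work, and both go by induction on \<open>n\<close>. For orthogonality
  (\<open>iterated_ext_orthogonal\<close>), let \<open>X \<rightarrow> Y \<rightarrow> B\<close> be the cofibre sequence defining an object of
  \<open>P\<^sub>n\<^sub>+\<^sub>1\<close>, a retract of \<open>Y\<close>. Every map out of the retract extends over \<open>Y\<close>, so it suffices to
  treat a map \<open>k\<close> out of \<open>Y\<close>. An \<open>n\<close>-fold composite kills the restriction of \<open>k\<close>
  to \<open>X\<close>, so after it \<open>k\<close> factors through \<open>B\<close>, and one more map of \<open>I\<close> kills what remains.

  For cofibre sequences (\<open>iterated_ext_resolution\<close>), choose \<open>A \<rightarrow> X \<rightarrow> Y\<close> for the pair of index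
  \<open>n\<close> and then \<open>B \<rightarrow> Y \<rightarrow> Z\<close> for \<open>(P, I)\<close>. The map \<open>X \<rightarrow> Z\<close> is an \<open>(n + 1)\<close>-fold composite, and
  by the octahedral axiom its fibre \<open>W\<close> is an extension \<open>A \<rightarrow> W \<rightarrow> B\<close>
  (\<open>octahedral_fibres\<close>). The octahedral axiom speaks of cofibres, which are the suspensions of
  the fibres; since the suspension is only an equivalence, passing back to the fibres uses that
  it is fully faithful and essentially surjective.
\<close>

section \<open>Zero and negative maps\<close>

context additive_category
begin

lemma carrier_hom_group [simp]: "carrier (hom_group S A B) = maps S A B"
  and mult_hom_group [simp]: "mult (hom_group S A B) = Add S"
  and one_hom_group [simp]: "one (hom_group S A B) = Zero S A B"
  by (simp_all add: hom_group_def)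

lemma maps_obj: "f \<in> maps S A B \<Longrightarrow> A \<in> Obj S \<and> B \<in> Obj S"
  using dom_obj cod_obj by (auto simp: maps_def)

lemma group_maps: "\<lbrakk>A \<in> Obj S; B \<in> Obj S\<rbrakk> \<Longrightarrow> group (hom_group S A B)"
  by (rule comm_group.axioms(2)[OF hom_group])

lemma zero_maps: "\<lbrakk>A \<in> Obj S; B \<in> Obj S\<rbrakk> \<Longrightarrow> Zero S A B \<in> maps S A B"
  using monoid.one_closed[OF group.is_monoid[OF group_maps]] by force

lemma Neg_eq_inv: "f \<in> maps S A B \<Longrightarrow> Neg S f = inv\<^bsub>hom_group S A B\<^esub> f"
  by (auto simp: Neg_def maps_def)

lemma neg_maps: "f \<in> maps S A B \<Longrightarrow> Neg S f \<in> maps S A B"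
  using group.inv_closed[OF group_maps] maps_obj by (force simp: Neg_eq_inv)

lemma neg_neg: "f \<in> maps S A B \<Longrightarrow> Neg S (Neg S f) = f"
  using group.inv_inv[OF group_maps, of A B f] maps_obj[of f A B] neg_maps[of f A B]
  by (simp add: Neg_eq_inv)

lemma neg_zero: "\<lbrakk>A \<in> Obj S; B \<in> Obj S\<rbrakk> \<Longrightarrow> Neg S (Zero S A B) = Zero S A B"
  using monoid.inv_one[OF group.is_monoid[OF group_maps]] zero_maps by (force simp: Neg_eq_inv)

text \<open>Composition with a fixed map, on either side, and the suspension are all additive, so
  one statement serves for the three of them.\<close>

lemma additive_zero_neg:
  assumes obj: "A \<in> Obj S" "B \<in> Obj S" "C \<in> Obj S" "D \<in> Obj S"
    and F: "\<And>f. f \<in> maps S A B \<Longrightarrow> F f \<in> maps S C D"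
    and add: "\<And>f g. \<lbrakk>f \<in> maps S A B; g \<in> maps S A B\<rbrakk> \<Longrightarrow> F (f \<oplus> g) = F f \<oplus> F g"
  shows "F (Zero S A B) = Zero S C D"
    and "f \<in> maps S A B \<Longrightarrow> F (Neg S f) = Neg S (F f)"
proof -
  have hom: "group_hom (hom_group S A B) (hom_group S C D) F"
    using obj F add by (auto simp: group_hom_def group_hom_axioms_def hom_def group_maps)
  show "F (Zero S A B) = Zero S C D"
    using group_hom.hom_one[OF hom] by simp
  show "F (Neg S f) = Neg S (F f)" if "f \<in> maps S A B"
    using group_hom.hom_inv[OF hom] that by (simp add: Neg_eq_inv[OF that] Neg_eq_inv[OF F[OF that]])
qed

lemma comp_zero_right: "\<lbrakk>g \<in> maps S B C; A \<in> Obj S\<rbrakk> \<Longrightarrow> g \<cdot> Zero S A B = Zero S A C"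
  using maps_obj[of g B C]
  by (intro additive_zero_neg(1)) (auto intro: comp_maps comp_add_right)

lemma comp_zero_left: "\<lbrakk>f \<in> maps S A B; C \<in> Obj S\<rbrakk> \<Longrightarrow> Zero S B C \<cdot> f = Zero S A C"
  using maps_obj[of f A B]
  by (intro additive_zero_neg(1)[where F = "\<lambda>h. h \<cdot> f"]) (auto intro: comp_maps comp_add_left)

lemma comp_neg_right: "\<lbrakk>f \<in> maps S A B; g \<in> maps S B C\<rbrakk> \<Longrightarrow> g \<cdot> Neg S f = Neg S (g \<cdot> f)"
  using maps_obj[of f A B] maps_obj[of g B C]
  by (intro additive_zero_neg(2)[where A = A and B = B and C = A and D = C])
    (auto intro: comp_maps comp_add_right)

lemma comp_neg_left: "\<lbrakk>f \<in> maps S A B; g \<in> maps S B C\<rbrakk> \<Longrightarrow> Neg S g \<cdot> f = Neg S (g \<cdot> f)"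
  using maps_obj[of f A B] maps_obj[of g B C]
  by (intro additive_zero_neg(2)[where F = "\<lambda>h. h \<cdot> f" and A = B and B = C and C = A and D = C])
    (auto intro: comp_maps comp_add_left)

lemma is_retract_refl: "A \<in> Obj S \<Longrightarrow> is_retract S A A"
  unfolding is_retract_def using ide_maps comp_ide_left by blast

lemma is_retract_trans:
  assumes "is_retract S A B" "is_retract S B C"
  shows "is_retract S A C"
proof -
  obtain i r where ir: "i \<in> maps S A B" "r \<in> maps S B A" "r \<cdot> i = Ide S A"
    using assms(1) by (auto simp: is_retract_def)
  obtain j s where js: "j \<in> maps S B C" "s \<in> maps S C B" "s \<cdot> j = Ide S B"
    using assms(2) by (auto simp: is_retract_def)
  have "(r \<cdot> s) \<cdot> (j \<cdot> i) = r \<cdot> (s \<cdot> (j \<cdot> i))"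
    by (rule comp_assoc[OF comp_maps[OF ir(1) js(1)] js(2) ir(2)])
  also have "s \<cdot> (j \<cdot> i) = i"
    using comp_assoc[OF ir(1) js(1) js(2)] js(3) comp_ide_left[OF ir(1)] by simp
  finally have "(r \<cdot> s) \<cdot> (j \<cdot> i) = Ide S A" using ir(3) by simp
  then show ?thesis
    using assms comp_maps[OF ir(1) js(1)] comp_maps[OF js(2) ir(2)]
    unfolding is_retract_def by blast
qed

text \<open>Every map out of a retract \<open>A\<close> of \<open>Y\<close> extends over \<open>Y\<close>, so a map that annihilates
  everything from \<open>Y\<close> annihilates everything from \<open>A\<close>.\<close>

lemma annihilates_retract:
  assumes "is_retract S A Y" and f: "f \<in> maps S B C"
    and Y: "\<And>k. k \<in> maps S Y B \<Longrightarrow> f \<cdot> k = Zero S Y C"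
    and h: "h \<in> maps S A B"
  shows "f \<cdot> h = Zero S A C"
proof -
  obtain i r where ir: "i \<in> maps S A Y" "r \<in> maps S Y A" "r \<cdot> i = Ide S A"
    using assms(1) by (auto simp: is_retract_def)
  have "h = (h \<cdot> r) \<cdot> i"
    using comp_assoc[OF ir(1,2) h] ir(3) comp_ide_right[OF h] by simp
  then have "f \<cdot> h = (f \<cdot> (h \<cdot> r)) \<cdot> i"
    using comp_assoc[OF ir(1) comp_maps[OF ir(2) h] f] by simp
  also have "\<dots> = Zero S A C"
    using Y[OF comp_maps[OF ir(2) h]] comp_zero_left[OF ir(1)] maps_obj[OF f] by simp
  finally show ?thesis .
qed

lemma maps_to_zero_object:
  assumes "zero_object S Z" "A \<in> Obj S"
  shows "f \<in> maps S A Z \<Longrightarrow> f = Zero S A Z"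
  using assms zero_maps by (metis zero_object_def)

lemma zero_objectI:
  assumes Z: "Z \<in> Obj S" and ide: "Ide S Z = Zero S Z Z"
  shows "zero_object S Z"
  unfolding zero_object_def
proof (intro conjI ballI Z)
  fix A assume A: "A \<in> Obj S"
  have "f = Zero S A Z" if "f \<in> maps S A Z" for f
    using comp_ide_left[OF that] comp_zero_left[OF that Z] ide by simp
  then show "\<exists>!f. f \<in> maps S A Z" using zero_maps[OF A Z] by blast
  have "f = Zero S Z A" if "f \<in> maps S Z A" for f
    using comp_ide_right[OF that] comp_zero_right[OF that Z] ide by simp
  then show "\<exists>!f. f \<in> maps S Z A" using zero_maps[OF Z A] by blast
qed

end

section \<open>Exactness of triangles and fibres\<close>

context triangulated_category
begin

lemma sus_zero:
  "\<lbrakk>A \<in> Obj S; B \<in> Obj S\<rbrakk> \<Longrightarrow> SusM S (Zero S A B) = Zero S (SusO S A) (SusO S B)"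
  by (intro additive_zero_neg(1)) (auto intro: sus_obj sus_maps sus_add)

lemma neg_sus_surj:
  assumes "A \<in> Obj S" "B \<in> Obj S" "g \<in> maps S (SusO S A) (SusO S B)"
  obtains f where "f \<in> maps S A B" "Neg S (SusM S f) = g"
proof -
  have "Neg S g \<in> SusM S ` maps S A B"
    using sus_fully_faithful[OF assms(1,2)] neg_maps[OF assms(3)] by (auto simp: bij_betw_def)
  then show thesis using that neg_neg[OF assms(3)] by auto
qed

lemma sus_inj:
  "\<lbrakk>f \<in> maps S A B; g \<in> maps S A B; SusM S f = SusM S g\<rbrakk> \<Longrightarrow> f = g"
  using sus_fully_faithful[of A B] maps_obj[of f A B] by (auto simp: bij_betw_def inj_on_def)

lemma zero_object_sus:
  assumes "zero_object S Z"
  shows "zero_object S (SusO S Z)"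
proof (rule zero_objectI)
  have Z: "Z \<in> Obj S" using assms by (simp add: zero_object_def)
  then show "SusO S Z \<in> Obj S" by (rule sus_obj)
  have "Ide S Z = Zero S Z Z" using maps_to_zero_object[OF assms Z] ide_maps[OF Z] by blast
  then show "Ide S (SusO S Z) = Zero S (SusO S Z) (SusO S Z)"
    using sus_ide[OF Z] sus_zero[OF Z Z] by simp
qed

lemma triangleI:
  "\<lbrakk>u \<in> maps S A B; v \<in> maps S B C; w \<in> maps S C (SusO S A)\<rbrakk> \<Longrightarrow> triangle S u v w"
  by (auto simp: triangle_def maps_def)

lemma exact_maps:
  assumes "Exact S u v w"
  shows "u \<in> maps S (Dom S u) (Cod S u)" "v \<in> maps S (Cod S u) (Cod S v)"
    "w \<in> maps S (Cod S v) (SusO S (Dom S u))"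
  using exact_triangle[OF assms] by (auto simp: triangle_def maps_def)

lemma exact_rotate_maps:
  assumes "u \<in> maps S A B" "v \<in> maps S B C" "w \<in> maps S C (SusO S A)"
  shows "Exact S u v w \<longleftrightarrow> Exact S v w (Neg S (SusM S u))"
  by (rule exact_rotate[OF triangleI[OF assms]])

lemma exact_fill_maps:
  assumes "Exact S u v w" "u \<in> maps S A B" "v \<in> maps S B C"
    and "Exact S u' v' w'" "u' \<in> maps S A' B'" "v' \<in> maps S B' C'"
    and "a \<in> maps S A A'" "b \<in> maps S B B'" "b \<cdot> u = u' \<cdot> a"
  obtains c where "c \<in> maps S C C'" "c \<cdot> v = v' \<cdot> b" "SusM S a \<cdot> w = w' \<cdot> c"
proof -
  have "Dom S w = C" "Dom S w' = C'"
    using exact_triangle[OF assms(1)] exact_triangle[OF assms(4)] assms(3,6)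
    by (auto simp: triangle_def maps_def)
  then show thesis
    using exact_fill[OF assms(1,4), of a b] assms that by (auto simp: maps_def)
qed

text \<open>Filling in a map from the given triangle to \<open>Z \<rightarrow> W \<rightarrow> W \<rightarrow> \<Sigma>Z\<close>, with \<open>Z\<close> a zero object,
  produces the factorization. That triangle is exact because its rotation is, up to the
  sign of a zero map, the identity triangle of \<open>W\<close> for the zero object \<open>\<Sigma>Z\<close>.\<close>

lemma exact_factor:
  assumes ex: "Exact S u v w" and u: "u \<in> maps S A B" and v: "v \<in> maps S B C"
    and f: "f \<in> maps S B W" and fu: "f \<cdot> u = Zero S A W"
  obtains h where "h \<in> maps S C W" "h \<cdot> v = f"
proof -
  obtain Z where Z: "zero_object S Z" using zero_object_exists ..
  then have Zo: "Z \<in> Obj S" by (simp add: zero_object_def)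
  have W: "W \<in> Obj S" and A: "A \<in> Obj S" using maps_obj f u by blast+
  have "Neg S (SusM S (Zero S Z W)) = Zero S (SusO S Z) (SusO S W)"
    using sus_zero neg_zero sus_obj Zo W by simp
  then have "Exact S (Ide S W) (Zero S W (SusO S Z)) (Neg S (SusM S (Zero S Z W)))"
    using exact_ide[OF W zero_object_sus[OF Z]] by simp
  then have ex': "Exact S (Zero S Z W) (Ide S W) (Zero S W (SusO S Z))"
    using exact_rotate_maps[OF zero_maps[OF Zo W] ide_maps[OF W] zero_maps[OF W sus_obj[OF Zo]]]
    by blast
  have "f \<cdot> u = Zero S Z W \<cdot> Zero S A Z"
    using fu comp_zero_left[OF zero_maps[OF A Zo] W] by simp
  then obtain c where "c \<in> maps S C W" "c \<cdot> v = Ide S W \<cdot> f"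
    using exact_fill_maps[OF ex u v ex' zero_maps[OF Zo W] ide_maps[OF W] zero_maps[OF A Zo] f]
    by blast
  then show thesis using that comp_ide_left[OF f] by simp
qed

text \<open>The axioms fill in the third map of a morphism of triangles, so both triangles are
  rotated once to make the lift that third map. It is then obtained as a map of suspensions
  and comes from a map \<open>D \<rightarrow> A\<close> by full faithfulness.\<close>

lemma exact_lift:
  assumes ex: "Exact S u v w" and u: "u \<in> maps S A B" and v: "v \<in> maps S B C"
    and g: "g \<in> maps S D B" and vg: "v \<cdot> g = Zero S D C"
  obtains h where "h \<in> maps S D A" "u \<cdot> h = g"
proof -
  obtain Z where Z: "zero_object S Z" using zero_object_exists ..
  then have Zo: "Z \<in> Obj S" by (simp add: zero_object_def)
  have D: "D \<in> Obj S" and A: "A \<in> Obj S" and C: "C \<in> Obj S"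
    using maps_obj g u v by blast+
  have w: "w \<in> maps S C (SusO S A)"
    using exact_maps(3)[OF ex] u v by (simp add: maps_def)
  have ex1: "Exact S v w (Neg S (SusM S u))"
    using exact_rotate_maps[OF u v w] ex by blast
  have i: "Ide S D \<in> maps S D D" by (rule ide_maps[OF D])
  have z: "Zero S Z (SusO S D) \<in> maps S Z (SusO S D)"
    by (rule zero_maps[OF Zo sus_obj[OF D]])
  have ex2: "Exact S (Zero S D Z) (Zero S Z (SusO S D)) (Neg S (SusM S (Ide S D)))"
    using exact_rotate_maps[OF i zero_maps[OF D Zo] z] exact_ide[OF D Z] by blast
  have "Zero S Z C \<cdot> Zero S D Z = v \<cdot> g"
    using vg comp_zero_left[OF zero_maps[OF D Zo] C] by simp
  then obtain c where c: "c \<in> maps S (SusO S D) (SusO S A)"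
    "SusM S g \<cdot> Neg S (SusM S (Ide S D)) = Neg S (SusM S u) \<cdot> c"
    using exact_fill_maps[OF ex2 zero_maps[OF D Zo] z ex1 v w g zero_maps[OF Zo C]] by blast
  have "c \<in> SusM S ` maps S D A"
    using sus_fully_faithful[OF D A] c(1) by (simp add: bij_betw_def)
  then obtain h where h: "h \<in> maps S D A" "SusM S h = c" by blast
  note sg = sus_maps[OF g] and su = sus_maps[OF u] and sh = sus_maps[OF h(1)]
  have "Neg S (SusM S g) = Neg S (SusM S (u \<cdot> h))"
    using c(2) comp_neg_right[OF sus_maps[OF i] sg] comp_neg_left[OF sh su]
    by (simp add: h(2) sus_ide[OF D] comp_ide_right[OF sg] sus_comp[OF h(1) u])
  then have "SusM S (u \<cdot> h) = SusM S g"
    using neg_neg[OF sg] neg_neg[OF sus_maps[OF comp_maps[OF h(1) u]]] by metis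
  then show thesis using that h(1) sus_inj[OF comp_maps[OF h(1) u] g] by blast
qed

text \<open>The cofibre of \<open>u\<close> is isomorphic to some \<open>\<Sigma>W\<close>; transporting the triangle along this
  isomorphism and rotating back exhibits \<open>W\<close> as the fibre.\<close>

lemma exact_fibre:
  assumes u: "u \<in> maps S X Y"
  obtains W a w where "W \<in> Obj S" "a \<in> maps S W X" "w \<in> maps S Y (SusO S W)" "Exact S a u w"
proof -
  have X: "X \<in> Obj S" and Y: "Y \<in> Obj S" using maps_obj u by blast+
  have "u \<in> Arr S" using u by (simp add: maps_def)
  then obtain m n where ex: "Exact S u m n" using exact_extend by blast
  define C where "C = Cod S m"
  have m: "m \<in> maps S Y C" and n: "n \<in> maps S C (SusO S X)"
    using exact_maps[OF ex] u by (auto simp: maps_def C_def)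
  have C: "C \<in> Obj S" using maps_obj m by blast
  obtain W e where W: "W \<in> Obj S" and "e \<in> iso_maps S (SusO S W) C"
    using sus_ess_surj[OF C] by blast
  then obtain e' where e: "e \<in> maps S (SusO S W) C" and e': "e' \<in> maps S C (SusO S W)"
    and ee': "e' \<cdot> e = Ide S (SusO S W)" "e \<cdot> e' = Ide S C"
    by (auto simp: iso_maps_def)
  have ne: "n \<cdot> e \<in> maps S (SusO S W) (SusO S X)" and em: "e' \<cdot> m \<in> maps S Y (SusO S W)"
    using comp_maps e e' m n by blast+
  have iso: "Ide S B \<in> iso_maps S B B" if "B \<in> Obj S" for B
    using ide_maps[OF that] comp_ide_left by (auto simp: iso_maps_def)
  have iso': "e' \<in> iso_maps S C (SusO S W)"
    using e e' ee' by (auto simp: iso_maps_def)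
  have "Exact S u (e' \<cdot> m) (n \<cdot> e)"
  proof (rule exact_iso[OF ex triangleI[OF u em ne]])
    show "Ide S X \<in> iso_maps S (Dom S u) (Dom S u)"
      using u iso[OF X] by (simp add: maps_def)
    show "Ide S Y \<in> iso_maps S (Dom S m) (Dom S (e' \<cdot> m))"
      using m em iso[OF Y] by (simp add: maps_def)
    show "e' \<in> iso_maps S (Dom S n) (Dom S (n \<cdot> e))"
      using n ne iso' by (simp add: maps_def)
    show "Ide S Y \<cdot> u = u \<cdot> Ide S X"
      using comp_ide_left[OF u] comp_ide_right[OF u] by simp
    show "e' \<cdot> m = (e' \<cdot> m) \<cdot> Ide S Y"
      using comp_ide_right[OF em] by simp
    show "SusM S (Ide S X) \<cdot> n = (n \<cdot> e) \<cdot> e'"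
      using sus_ide[OF X] comp_ide_left[OF n] comp_assoc[OF e' e n] ee' comp_ide_right[OF n]
      by simp
  qed
  moreover obtain a where a: "a \<in> maps S W X" "Neg S (SusM S a) = n \<cdot> e"
    using neg_sus_surj[OF W X ne] .
  ultimately have "Exact S a u (e' \<cdot> m)"
    using exact_rotate_maps[OF a(1) u em] by simp
  then show thesis using that W a(1) em by blast
qed

text \<open>The octahedral axiom for fibres instead of cofibres. Applied to the rotated triangles it
  gives an exact triangle \<open>\<Sigma>A \<rightarrow> \<Sigma>W \<rightarrow> \<Sigma>B \<rightarrow> \<Sigma>\<Sigma>A\<close>. Its maps are \<open>-\<Sigma>x\<close>, \<open>-\<Sigma>y\<close> and
  \<open>-\<Sigma>(w \<cdot> u')\<close>, which makes it the threefold rotation of a triangle \<open>A \<rightarrow> W \<rightarrow> B \<rightarrow> \<Sigma>A\<close>.\<close>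

lemma octahedral_fibres:
  assumes ex: "Exact S u v w" and u: "u \<in> maps S A X" and v: "v \<in> maps S X Y"
    and ex': "Exact S u' v' w'" and u': "u' \<in> maps S B Y" and v': "v' \<in> maps S Y Z"
  obtains W a x y where "W \<in> Obj S" "a \<in> maps S W X" "cofibre_sequence S a (v' \<cdot> v)"
    "x \<in> maps S A W" "y \<in> maps S W B" "cofibre_sequence S x y"
proof -
  have w: "w \<in> maps S Y (SusO S A)" and w': "w' \<in> maps S Z (SusO S B)"
    using exact_maps(3)[OF ex] exact_maps(3)[OF ex'] u v u' v' by (simp_all add: maps_def)
  have A: "A \<in> Obj S" and B: "B \<in> Obj S" using maps_obj u u' by blast+
  have vv: "v' \<cdot> v \<in> maps S X Z" by (rule comp_maps[OF v v'])
  obtain W a c where W: "W \<in> Obj S" and a: "a \<in> maps S W X"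
    and c: "c \<in> maps S Z (SusO S W)" and exW: "Exact S a (v' \<cdot> v) c"
    using exact_fibre[OF vv] .
  have "Cod S v = Dom S v'" "Cod S w = SusO S A" "Cod S w' = SusO S B" "Cod S c = SusO S W"
    using v v' w w' c by (simp_all add: maps_def)
  moreover have "Exact S v w (Neg S (SusM S u))" "Exact S v' w' (Neg S (SusM S u'))"
    "Exact S (v' \<cdot> v) c (Neg S (SusM S a))"
    using exact_rotate_maps[OF u v w] exact_rotate_maps[OF u' v' w'] exact_rotate_maps[OF a vv c]
      ex ex' exW by blast+
  ultimately obtain f g where f: "f \<in> maps S (SusO S A) (SusO S W)"
    and g: "g \<in> maps S (SusO S W) (SusO S B)"
    and fg: "Exact S f g (SusM S w \<cdot> Neg S (SusM S u'))"
    using octahedral[of v w "Neg S (SusM S u)" v' w' "Neg S (SusM S u')" c "Neg S (SusM S a)"]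
    by auto
  obtain x where x: "x \<in> maps S A W" "Neg S (SusM S x) = f"
    using neg_sus_surj[OF A W f] .
  obtain y where y: "y \<in> maps S W B" "Neg S (SusM S y) = g"
    using neg_sus_surj[OF W B g] .
  define z where "z = w \<cdot> u'"
  have z: "z \<in> maps S B (SusO S A)" unfolding z_def by (rule comp_maps[OF u' w])
  have "SusM S w \<cdot> Neg S (SusM S u') = Neg S (SusM S z)"
    using comp_neg_right[OF sus_maps[OF u'] sus_maps[OF w]] sus_comp[OF u' w]
    by (simp add: z_def)
  then have "Exact S (Neg S (SusM S x)) (Neg S (SusM S y)) (Neg S (SusM S z))"
    using fg x(2) y(2) by simp
  then have "Exact S z (Neg S (SusM S x)) (Neg S (SusM S y))"
    using exact_rotate_maps[OF z] f g x(2) y(2) by blast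
  then have "Exact S y z (Neg S (SusM S x))"
    using exact_rotate_maps[OF y(1) z] f x(2) by blast
  then have "Exact S x y z"
    using exact_rotate_maps[OF x(1) y(1) z] by blast
  then show thesis
    using that W a exW x(1) y(1) unfolding cofibre_sequence_def by blast
qed

section \<open>Recognizing projective classes\<close>

lemma projective_classI:
  assumes P: "P \<subseteq> Obj S" and I: "I \<subseteq> Arr S"
    and retract: "\<And>A Y. \<lbrakk>is_retract S A Y; Y \<in> P\<rbrakk> \<Longrightarrow> A \<in> P"
    and ideal: "\<And>f h X Y Z. \<lbrakk>f \<in> I; f \<in> maps S X Y; h \<in> maps S Y Z\<rbrakk> \<Longrightarrow> h \<cdot> f \<in> I"
    and orth: "\<And>f A X Y k. \<lbrakk>f \<in> I; A \<in> P; f \<in> maps S X Y; k \<in> maps S A X\<rbrakk>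
      \<Longrightarrow> f \<cdot> k = Zero S A Y"
    and resolve: "\<And>X. X \<in> Obj S \<Longrightarrow> \<exists>A \<in> P. \<exists>Y \<in> Obj S. \<exists>u \<in> maps S A X. \<exists>v \<in> maps S X Y.
        cofibre_sequence S u v \<and> v \<in> I"
  shows "projective_class S P I"
proof -
  have Idom: "f \<in> maps S (Dom S f) (Cod S f)" if "f \<in> Arr S" for f
    using that by (simp add: maps_def)
  have "f \<in> I" if f: "f \<in> null_maps S P" for f
  proof -
    have fm: "f \<in> maps S (Dom S f) (Cod S f)"
      using f Idom by (simp add: null_maps_def)
    then obtain A Y u v w where *: "A \<in> P" "u \<in> maps S A (Dom S f)" "v \<in> maps S (Dom S f) Y"
      "Exact S u v w" "v \<in> I"
      using resolve[of "Dom S f"] maps_obj unfolding cofibre_sequence_def by blast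
    have "f \<cdot> u = Zero S A (Cod S f)" using f * by (auto simp: null_maps_def)
    then obtain h where "h \<in> maps S Y (Cod S f)" "h \<cdot> v = f"
      using exact_factor[OF *(4,2,3) fm] by blast
    then show ?thesis using ideal * by blast
  qed
  moreover have "f \<in> null_maps S P" if "f \<in> I" for f
    using that I orth[OF that _ Idom] by (auto simp: null_maps_def)
  moreover have "X \<in> P" if X: "X \<in> proj_objects S I" for X
  proof -
    have Xo: "X \<in> Obj S" using X by (simp add: proj_objects_def)
    then obtain A Y u v w where *: "A \<in> P" "u \<in> maps S A X" "v \<in> maps S X Y"
      "Exact S u v w" "v \<in> I"
      using resolve unfolding cofibre_sequence_def by blast
    have "v \<cdot> Ide S X = Zero S X Y"
      using X * ide_maps[OF Xo] by (auto simp: proj_objects_def maps_def)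
    then obtain h where "h \<in> maps S X A" "u \<cdot> h = Ide S X"
      using exact_lift[OF *(4,2,3) ide_maps[OF Xo]] by blast
    then have "is_retract S X A"
      using * P Xo by (auto simp: is_retract_def)
    then show ?thesis using retract * by blast
  qed
  moreover have "A \<in> proj_objects S I" if "A \<in> P" for A
    using that P I orth[OF _ that Idom] by (auto simp: proj_objects_def)
  ultimately have "null_maps S P = I" "proj_objects S I = P" by blast+
  then show ?thesis
    using P I resolve by (simp add: projective_class_def)
qed

section \<open>Iterated extensions and composites\<close>

context
  fixes P I
  assumes PI: "projective_class S P I"
begin

lemma projective_class_resolve:
  assumes "X \<in> Obj S"
  obtains A Y u v w where "A \<in> P" "Y \<in> Obj S" "u \<in> maps S A X" "v \<in> maps S X Y"
    "Exact S u v w" "v \<in> I"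
  using PI assms unfolding projective_class_def cofibre_sequence_def by blast

lemma projective_class_orthogonal:
  assumes "f \<in> I" "A \<in> P" "f \<in> maps S X Y" "k \<in> maps S A X"
  shows "f \<cdot> k = Zero S A Y"
proof -
  have "f \<in> null_maps S P" using PI assms by (simp add: projective_class_def)
  then show ?thesis using assms by (auto simp: null_maps_def maps_def)
qed

lemma projective_class_ideal:
  assumes f: "f \<in> I" "f \<in> maps S X Y" and h: "h \<in> maps S Y Z"
  shows "h \<cdot> f \<in> I"
proof -
  have hf: "h \<cdot> f \<in> maps S X Z" by (rule comp_maps[OF f(2) h])
  have "(h \<cdot> f) \<cdot> k = Zero S A Z" if "A \<in> P" and k: "k \<in> maps S A X" for A k
    using comp_assoc[OF k f(2) h] projective_class_orthogonal[OF f(1) that(1) f(2) k]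
      comp_zero_right[OF h] maps_obj[OF k] by simp
  then have "h \<cdot> f \<in> null_maps S P" using hf by (auto simp: null_maps_def maps_def)
  then show ?thesis using PI by (simp add: projective_class_def)
qed

lemma projective_class_retract:
  assumes "is_retract S A Y" "Y \<in> P"
  shows "A \<in> P"
proof -
  have "f \<cdot> g = Zero S A (Cod S f)" if "f \<in> I" "g \<in> maps S A (Dom S f)" for f g
  proof (rule annihilates_retract[OF assms(1) _ _ that(2)])
    show f: "f \<in> maps S (Dom S f) (Cod S f)"
      using PI that(1) by (auto simp: projective_class_def maps_def)
    show "f \<cdot> k = Zero S Y (Cod S f)" if "k \<in> maps S Y (Dom S f)" for k
      by (rule projective_class_orthogonal[OF \<open>f \<in> I\<close> assms(2) f that])
  qed
  then have "A \<in> proj_objects S I" using assms by (auto simp: proj_objects_def is_retract_def)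
  then show ?thesis using PI by (simp add: projective_class_def)
qed

lemma composites_arr: "composites S I (Suc n) \<subseteq> Arr S"
proof (induction n)
  case 0
  show ?case using PI by (simp add: projective_class_def)
next
  case (Suc n)
  show ?case
  proof
    fix k assume "k \<in> composites S I (Suc (Suc n))"
    then obtain f g where fg: "k = g \<cdot> f" "f \<in> composites S I (Suc n)" "g \<in> I"
      "Cod S f = Dom S g"
      by auto
    then have "f \<in> Arr S" "g \<in> Arr S"
      using Suc PI by (auto simp: projective_class_def)
    with fg show "k \<in> Arr S"
      using comp_maps[of f "Dom S f" "Cod S f" g "Cod S g"] by (simp add: maps_def)
  qed
qed

lemma iterated_ext_obj: "iterated_ext S P (Suc n) \<subseteq> Obj S"
  using PI by (cases n) (auto simp: projective_class_def is_retract_def)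

lemma iterated_ext_retract:
  "\<lbrakk>is_retract S A Y; Y \<in> iterated_ext S P (Suc n)\<rbrakk> \<Longrightarrow> A \<in> iterated_ext S P (Suc n)"
  by (cases n) (use projective_class_retract is_retract_trans in \<open>fastforce+\<close>)

lemma composites_split:
  assumes "k \<in> composites S I (Suc (Suc n))" "k \<in> maps S X Z"
  obtains f g Y where "k = g \<cdot> f" "f \<in> composites S I (Suc n)" "g \<in> I"
    "f \<in> maps S X Y" "g \<in> maps S Y Z"
proof -
  obtain f g where fg: "k = g \<cdot> f" "f \<in> composites S I (Suc n)" "g \<in> I" "Cod S f = Dom S g"
    using assms(1) by auto
  have f: "f \<in> maps S (Dom S f) (Cod S f)" and g: "g \<in> maps S (Cod S f) (Cod S g)"
    using fg composites_arr[of n] PI by (auto simp: maps_def projective_class_def)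
  have "Dom S f = X" "Cod S g = Z"
    using comp_maps[OF f g] assms(2) fg(1) by (auto simp: maps_def)
  then show thesis using that fg f g by simp
qed

lemma composites_ideal:
  assumes "k \<in> composites S I (Suc n)" "k \<in> maps S X Y" "h \<in> maps S Y Z"
  shows "h \<cdot> k \<in> composites S I (Suc n)"
proof (cases n)
  case 0
  then show ?thesis using projective_class_ideal assms by simp
next
  case (Suc m)
  obtain f g V where fg: "k = g \<cdot> f" "f \<in> composites S I (Suc m)" "g \<in> I"
    "f \<in> maps S X V" "g \<in> maps S V Y"
    using composites_split assms Suc by metis
  have hg: "h \<cdot> g \<in> I" "h \<cdot> g \<in> maps S V Z"
    using projective_class_ideal comp_maps fg assms(3) by blast+
  have eq: "h \<cdot> k = (h \<cdot> g) \<cdot> f" using comp_assoc[OF fg(4,5) assms(3)] fg(1) by simp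
  have "Cod S f = Dom S (h \<cdot> g)" using fg(4) hg(2) by (simp add: maps_def)
  then show ?thesis using eq fg(2) hg(1) by (auto simp: Suc)
qed

text \<open>Maps out of the middle of \<open>X \<rightarrow> Y \<rightarrow> B\<close>: the first \<open>n\<close> factors of the composite annihilate
  the part on \<open>X\<close>, after which only a map from \<open>B\<close> is left for the last factor to annihilate.\<close>

lemma iterated_ext_orthogonal:
  assumes "f \<in> composites S I (Suc n)" "A \<in> iterated_ext S P (Suc n)"
    and "f \<in> maps S V W" "k \<in> maps S A V"
  shows "f \<cdot> k = Zero S A W"
  using assms
proof (induction n arbitrary: f A V W k)
  case 0
  then show ?case using projective_class_orthogonal by simp
next
  case (Suc n)
  obtain p q U where pq: "f = q \<cdot> p" "p \<in> composites S I (Suc n)" "q \<in> I"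
    "p \<in> maps S V U" "q \<in> maps S U W"
    using composites_split[OF Suc.prems(1,3)] .
  obtain X Y B u v w where Y: "is_retract S A Y" and X: "X \<in> iterated_ext S P (Suc n)"
    and B: "B \<in> P" and u: "u \<in> maps S X Y" and v: "v \<in> maps S Y B" and ex: "Exact S u v w"
    using Suc.prems(2) by (auto simp: cofibre_sequence_def)
  show ?case
  proof (rule annihilates_retract[OF Y Suc.prems(3) _ Suc.prems(4)])
    fix h assume h: "h \<in> maps S Y V"
    have "p \<cdot> (h \<cdot> u) = Zero S X U"
      by (rule Suc.IH[OF pq(2) X pq(4) comp_maps[OF u h]])
    then have "(p \<cdot> h) \<cdot> u = Zero S X U" using comp_assoc[OF u h pq(4)] by simp
    then obtain l where l: "l \<in> maps S B U" "l \<cdot> v = p \<cdot> h"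
      using exact_factor[OF ex u v comp_maps[OF h pq(4)]] by blast
    have "f \<cdot> h = q \<cdot> (l \<cdot> v)" using comp_assoc[OF h pq(4,5)] pq(1) l(2) by simp
    also have "\<dots> = (q \<cdot> l) \<cdot> v" using comp_assoc[OF v l(1) pq(5)] by simp
    also have "\<dots> = Zero S Y W"
      using projective_class_orthogonal[OF pq(3) B pq(5) l(1)] comp_zero_left[OF v]
        maps_obj[OF pq(5)] by simp
    finally show "f \<cdot> h = Zero S Y W" .
  qed
qed

lemma iterated_ext_resolution:
  assumes "X \<in> Obj S"
  shows "\<exists>A \<in> iterated_ext S P (Suc n). \<exists>Y \<in> Obj S. \<exists>u \<in> maps S A X. \<exists>v \<in> maps S X Y.
    cofibre_sequence S u v \<and> v \<in> composites S I (Suc n)"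
proof (induction n)
  case 0
  show ?case using PI assms by (simp add: projective_class_def)
next
  case (Suc n)
  then obtain A Y u v w where A: "A \<in> iterated_ext S P (Suc n)" and Y: "Y \<in> Obj S"
    and u: "u \<in> maps S A X" and v: "v \<in> maps S X Y" and ex: "Exact S u v w"
    and vI: "v \<in> composites S I (Suc n)"
    unfolding cofibre_sequence_def by blast
  obtain B Z u' v' w' where B: "B \<in> P" and Z: "Z \<in> Obj S" and u': "u' \<in> maps S B Y"
    and v': "v' \<in> maps S Y Z" and ex': "Exact S u' v' w'" and vI': "v' \<in> I"
    using projective_class_resolve[OF Y] .
  obtain W a x y where W: "W \<in> Obj S" and a: "a \<in> maps S W X"
    and aW: "cofibre_sequence S a (v' \<cdot> v)"
    and x: "x \<in> maps S A W" and y: "y \<in> maps S W B" and xy: "cofibre_sequence S x y"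
    using octahedral_fibres[OF ex u v ex' u' v'] .
  have "W \<in> iterated_ext S P (Suc (Suc n))"
    using is_retract_refl[OF W] A B x y xy unfolding iterated_ext.simps by blast
  moreover have "Cod S v = Dom S v'" using v v' by (simp add: maps_def)
  then have "v' \<cdot> v \<in> composites S I (Suc (Suc n))" using vI vI' by auto
  ultimately show ?case using a Z comp_maps[OF v v'] aW by blast
qed

end

end

theorem theorem1p1:
  fixes S :: "('o, 'm, 'e) tri_category_scheme"
    and P :: "'o set" and I :: "'m set" and n :: nat
  assumes "triangulated_category S"
    and "projective_class S P I"
    and "n \<ge> 1"
  shows "projective_class S (iterated_ext S P n) (composites S I n)"
proof -
  interpret triangulated_category S by (rule assms(1))
  obtain m where n: "n = Suc m" using assms(3) by (cases n) auto
  note PI = assms(2)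
  show ?thesis
    unfolding n
  proof (rule projective_classI)
    show "iterated_ext S P (Suc m) \<subseteq> Obj S" by (rule iterated_ext_obj[OF PI])
    show "composites S I (Suc m) \<subseteq> Arr S" by (rule composites_arr[OF PI])
  qed (blast intro: iterated_ext_retract[OF PI] composites_ideal[OF PI]
      iterated_ext_orthogonal[OF PI] iterated_ext_resolution[OF PI])+
qed

end
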